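(* Let $H$ be a Heyting algebra such that the Boolean algebra $H_{\neg\neg}$ of regular elements of $H$ is a sublattice of $H$. Let $M$ be a Heyting module over $H$. Then $M_{\neg\neg}$, with the joins, the action of $H_{\neg\neg}$ and the negation map $\neg_M$ restricted from $M$, is a Boolean module over the Boolean algebra $H_{\neg\neg}$.
   Context: Lattices have all finite meets and joins (hence a least element $0$ and a greatest element $1$). A join semilattice is a poset in which every finite subset, including the empty one, has a join; its least element is $0$. For a distributive lattice $L$, a distributive module over $L$ is a join semilattice $M$ with an action $L\times M\to M$, $(x,m)\mapsto x\wedge m$, order preserving in both variables, such that $1\wedge m=m$, $0\wedge m=0$, $(x\wedge y)\wedge m=x\wedge(y\wedge m)$, $(x\vee y)\wedge m=(x\wedge m)\vee(y\wedge m)$, $x\wedge(m\vee n)=(x\wedge m)\vee(x\wedge n)$. A Heyting algebra $H$ is a lattice such that for all $y,z\in H$ there is $(y\to z)_H\in H$ with $x\wedge y\le z\Leftrightarrow x\le (y\to z)_H$ for all $x\in H$. A Heyting module over $H$ is a distributive module $M$ over $H$ such that for all $m,n\in M$ there is $(m\to n)_M\in H$ with $x\wedge m\le n\Leftrightarrow x\le(m\to n)_M$ for all $x\in H$. Write $\neg x=(x\to0)_H$ for $x\in H$ and $\neg_M(m)=(m\to 0)_M\in H$ for $m\in M$. An element $x\in H$ is regular if $\neg\neg x=x$; $H_{\neg\neg}$ is the set of regular elements, which is a Boolean algebra with complementation given by $\neg$ (its meets agree with those of $H$, its joins need not in general). Set $M_{\neg\neg}:=\{m\in M : \neg_M(m)\in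 H_{\neg\neg}\}$. A Boolean module over a Boolean algebra $(B,\neg_B)$ is a distributive module $N$ over the lattice $B$ together with an operation $\neg_N:N\to B$ such that, for all $x\in B$ and $m,n\in N$, $\neg_N(0)=1$, $\neg_N(x\wedge m)=\neg_B(x)\vee\neg_N(m)$, and $\neg_N(m\vee n)=\neg_N(m)\wedge\neg_N(n)$. *)

theory Defs
  imports "HOL-Algebra.Lattice"
begin

text \<open>
  Lattices and semilattices are the carrier-based orders of HOL-Algebra, so that substructures are
  obtained by shrinking the carrier.  Joins, meets, \<open>\<bottom>\<close> and \<open>\<top>\<close> are those of the order on the carrier
  at hand; in a substructure they need not a priori agree with those of the ambient structure.
\<close>

locale distributive_lattice = bounded_lattice L for L (structure) +
  assumes inf_sup_distrib:
    "\<lbrakk>x \<in> carrier L; y \<in> carrier L; z \<in> carrier L\<rbrakk>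
      \<Longrightarrow> x \<sqinter> (y \<squnion> z) = (x \<sqinter> y) \<squnion> (x \<sqinter> z)"

locale join_semilattice = upper_semilattice M + weak_partial_order_bottom M for M (structure)

locale distributive_module = L: distributive_lattice L + M: join_semilattice M
  for L :: "('a, 'c) gorder_scheme" (structure)
    and M :: "('b, 'd) gorder_scheme" (structure)
    and act :: "'a \<Rightarrow> 'b \<Rightarrow> 'b" +
  assumes act_closed: "\<lbrakk>x \<in> carrier L; m \<in> carrier M\<rbrakk> \<Longrightarrow> act x m \<in> carrier M"
    and act_mono_left:
      "\<lbrakk>x \<in> carrier L; y \<in> carrier L; m \<in> carrier M; x \<sqsubseteq>\<^bsub>L\<^esub> y\<rbrakk>
        \<Longrightarrow> act x m \<sqsubseteq>\<^bsub>M\<^esub> act y m"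
    and act_mono_right:
      "\<lbrakk>x \<in> carrier L; m \<in> carrier M; n \<in> carrier M; m \<sqsubseteq>\<^bsub>M\<^esub> n\<rbrakk>
        \<Longrightarrow> act x m \<sqsubseteq>\<^bsub>M\<^esub> act x n"
    and act_top: "m \<in> carrier M \<Longrightarrow> act \<top>\<^bsub>L\<^esub> m = m"
    and act_bottom: "m \<in> carrier M \<Longrightarrow> act \<bottom>\<^bsub>L\<^esub> m = \<bottom>\<^bsub>M\<^esub>"
    and act_meet:
      "\<lbrakk>x \<in> carrier L; y \<in> carrier L; m \<in> carrier M\<rbrakk>
        \<Longrightarrow> act (x \<sqinter>\<^bsub>L\<^esub> y) m = act x (act y m)"
    and act_join_left:
      "\<lbrakk>x \<in> carrier L; y \<in> carrier L; m \<in> carrier M\<rbrakk>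
        \<Longrightarrow> act (x \<squnion>\<^bsub>L\<^esub> y) m = act x m \<squnion>\<^bsub>M\<^esub> act y m"
    and act_join_right:
      "\<lbrakk>x \<in> carrier L; m \<in> carrier M; n \<in> carrier M\<rbrakk>
        \<Longrightarrow> act x (m \<squnion>\<^bsub>M\<^esub> n) = act x m \<squnion>\<^bsub>M\<^esub> act x n"

locale heyting_algebra = bounded_lattice H for H (structure) +
  assumes imp_exists:
    "\<lbrakk>y \<in> carrier H; z \<in> carrier H\<rbrakk>
      \<Longrightarrow> \<exists>w\<in>carrier H. \<forall>x\<in>carrier H. x \<sqinter> y \<sqsubseteq> z \<longleftrightarrow> x \<sqsubseteq> w"

text \<open>
  Heyting algebras are distributive, so in \<open>heyting_module\<close> below the distributivity of \<open>H\<close>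
  inherited from \<open>distributive_module\<close> is not an additional assumption.
\<close>

sublocale heyting_algebra \<subseteq> distributive_lattice H
proof
  fix x y z
  assume c: "x \<in> carrier H" "y \<in> carrier H" "z \<in> carrier H"
  let ?r = "(x \<sqinter> y) \<squnion> (x \<sqinter> z)"
  have xy: "x \<sqinter> y \<in> carrier H" and xz: "x \<sqinter> z \<in> carrier H" and yz: "y \<squnion> z \<in> carrier H"
    by (rule meet_closed[OF c(1,2)] meet_closed[OF c(1,3)] join_closed[OF c(2,3)])+
  have xyz: "x \<sqinter> (y \<squnion> z) \<in> carrier H" by (rule meet_closed[OF c(1) yz])
  have rc: "?r \<in> carrier H" by (rule join_closed[OF xy xz])
  obtain w where w: "w \<in> carrier H"
    and imp: "\<forall>u\<in>carrier H. u \<sqinter> x \<sqsubseteq> ?r \<longleftrightarrow> u \<sqsubseteq> w"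
    using imp_exists[OF c(1) rc] by (elim bexE)
  have "y \<sqinter> x \<sqsubseteq> ?r" by (subst meet_comm) (rule join_left[OF xy xz])
  then have "y \<sqsubseteq> w" using bspec[OF imp c(2)] by (rule iffD1[rotated])
  moreover have "z \<sqinter> x \<sqsubseteq> ?r" by (subst meet_comm) (rule join_right[OF xy xz])
  then have "z \<sqsubseteq> w" using bspec[OF imp c(3)] by (rule iffD1[rotated])
  ultimately have "y \<squnion> z \<sqsubseteq> w" by (rule join_le[OF _ _ c(2,3) w])
  with bspec[OF imp yz] have "(y \<squnion> z) \<sqinter> x \<sqsubseteq> ?r" by (rule iffD2)
  then have le: "x \<sqinter> (y \<squnion> z) \<sqsubseteq> ?r" by (subst meet_comm)
  have "x \<sqinter> y \<sqsubseteq> y \<squnion> z"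
    by (rule le_trans[OF meet_right[OF c(1,2)] join_left[OF c(2,3)] xy c(2) yz])
  then have 1: "x \<sqinter> y \<sqsubseteq> x \<sqinter> (y \<squnion> z)"
    by (rule meet_le[OF meet_left[OF c(1,2)] _ c(1) yz xy])
  have "x \<sqinter> z \<sqsubseteq> y \<squnion> z"
    by (rule le_trans[OF meet_right[OF c(1,3)] join_right[OF c(2,3)] xz c(3) yz])
  then have 2: "x \<sqinter> z \<sqsubseteq> x \<sqinter> (y \<squnion> z)"
    by (rule meet_le[OF meet_left[OF c(1,3)] _ c(1) yz xz])
  have ge: "?r \<sqsubseteq> x \<sqinter> (y \<squnion> z)" by (rule join_le[OF 1 2 xy xz xyz])
  show "x \<sqinter> (y \<squnion> z) = ?r" by (rule le_antisym[OF le ge xyz rc])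
qed

definition heyting_imp :: "('a, 'c) gorder_scheme \<Rightarrow> 'a \<Rightarrow> 'a \<Rightarrow> 'a" where
  "heyting_imp H y z =
    (THE w. w \<in> carrier H \<and> (\<forall>x\<in>carrier H. x \<sqinter>\<^bsub>H\<^esub> y \<sqsubseteq>\<^bsub>H\<^esub> z \<longleftrightarrow> x \<sqsubseteq>\<^bsub>H\<^esub> w))"

definition heyting_neg :: "('a, 'c) gorder_scheme \<Rightarrow> 'a \<Rightarrow> 'a" where
  "heyting_neg H x = heyting_imp H x \<bottom>\<^bsub>H\<^esub>"

definition regular_elements :: "('a, 'c) gorder_scheme \<Rightarrow> 'a set" where
  "regular_elements H = {x \<in> carrier H. heyting_neg H (heyting_neg H x) = x}"

definition regular_part :: "('a, 'c) gorder_scheme \<Rightarrow> ('a, 'c) gorder_scheme" where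
  "regular_part H = H\<lparr>carrier := regular_elements H\<rparr>"

locale heyting_module = H: heyting_algebra H + distributive_module H M act
  for H :: "('a, 'c) gorder_scheme" (structure)
    and M :: "('b, 'd) gorder_scheme" (structure)
    and act :: "'a \<Rightarrow> 'b \<Rightarrow> 'b" +
  assumes module_imp_exists:
    "\<lbrakk>m \<in> carrier M; n \<in> carrier M\<rbrakk>
      \<Longrightarrow> \<exists>w\<in>carrier H. \<forall>x\<in>carrier H. act x m \<sqsubseteq>\<^bsub>M\<^esub> n \<longleftrightarrow> x \<sqsubseteq>\<^bsub>H\<^esub> w"

definition module_imp ::
    "('a, 'c) gorder_scheme \<Rightarrow> ('b, 'd) gorder_scheme \<Rightarrow> ('a \<Rightarrow> 'b \<Rightarrow> 'b) \<Rightarrow> 'b \<Rightarrow> 'b \<Rightarrow> 'a" where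
  "module_imp H M act m n =
    (THE w. w \<in> carrier H \<and> (\<forall>x\<in>carrier H. act x m \<sqsubseteq>\<^bsub>M\<^esub> n \<longleftrightarrow> x \<sqsubseteq>\<^bsub>H\<^esub> w))"

definition module_neg ::
    "('a, 'c) gorder_scheme \<Rightarrow> ('b, 'd) gorder_scheme \<Rightarrow> ('a \<Rightarrow> 'b \<Rightarrow> 'b) \<Rightarrow> 'b \<Rightarrow> 'a" where
  "module_neg H M act m = module_imp H M act m \<bottom>\<^bsub>M\<^esub>"

definition regular_module_elements ::
    "('a, 'c) gorder_scheme \<Rightarrow> ('b, 'd) gorder_scheme \<Rightarrow> ('a \<Rightarrow> 'b \<Rightarrow> 'b) \<Rightarrow> 'b set" where
  "regular_module_elements H M act = {m \<in> carrier M. module_neg H M act m \<in> regular_elements H}"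

definition regular_module_part ::
    "('a, 'c) gorder_scheme \<Rightarrow> ('b, 'd) gorder_scheme \<Rightarrow> ('a \<Rightarrow> 'b \<Rightarrow> 'b) \<Rightarrow> ('b, 'd) gorder_scheme" where
  "regular_module_part H M act = M\<lparr>carrier := regular_module_elements H M act\<rparr>"

text \<open>A sublattice is closed under all finite meets and joins, the empty ones included.\<close>

definition sublattice :: "'a set \<Rightarrow> ('a, 'c) gorder_scheme \<Rightarrow> bool" where
  "sublattice S L \<longleftrightarrow> S \<subseteq> carrier L \<and> \<bottom>\<^bsub>L\<^esub> \<in> S \<and> \<top>\<^bsub>L\<^esub> \<in> S \<and>
    (\<forall>x\<in>S. \<forall>y\<in>S. x \<sqinter>\<^bsub>L\<^esub> y \<in> S \<and> x \<squnion>\<^bsub>L\<^esub> y \<in> S)"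

locale boolean_lattice = distributive_lattice B for B (structure) and neg +
  assumes neg_closed: "x \<in> carrier B \<Longrightarrow> neg x \<in> carrier B"
    and meet_neg: "x \<in> carrier B \<Longrightarrow> x \<sqinter> neg x = \<bottom>"
    and join_neg: "x \<in> carrier B \<Longrightarrow> x \<squnion> neg x = \<top>"

locale boolean_module = B: boolean_lattice B negB + distributive_module B N act
  for B :: "('a, 'c) gorder_scheme" (structure)
    and negB :: "'a \<Rightarrow> 'a"
    and N :: "('b, 'd) gorder_scheme" (structure)
    and act :: "'a \<Rightarrow> 'b \<Rightarrow> 'b"
    and negN :: "'b \<Rightarrow> 'a" +
  assumes negN_closed: "m \<in> carrier N \<Longrightarrow> negN m \<in> carrier B"
    and negN_bottom: "negN \<bottom>\<^bsub>N\<^esub> = \<top>\<^bsub>B\<^esub>"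
    and negN_act:
      "\<lbrakk>x \<in> carrier B; m \<in> carrier N\<rbrakk> \<Longrightarrow> negN (act x m) = negB x \<squnion>\<^bsub>B\<^esub> negN m"
    and negN_join:
      "\<lbrakk>m \<in> carrier N; n \<in> carrier N\<rbrakk> \<Longrightarrow> negN (m \<squnion>\<^bsub>N\<^esub> n) = negN m \<sqinter>\<^bsub>B\<^esub> negN n"

end

(* If the regular elements form a sublattice, then x \<squnion> \<not>x is regular for regular x, and since
   \<not>(x \<squnion> \<not>x) = \<bottom> always holds, x \<squnion> \<not>x = \<top> already in H.  Hence y \<sqinter> x \<sqsubseteq> z is equivalent to
   y \<sqsubseteq> \<not>x \<squnion> z for every z in H.  Together with y \<sqsubseteq> \<not>(x m) \<longleftrightarrow> y \<sqinter> x \<sqsubseteq> \<not>m this gives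
   \<not>(x m) = \<not>x \<squnion> \<not>m; the other two laws of the negation hold in every Heyting module. *)
theory Submission
  imports Defs
begin

section \<open>Shrinking the carrier of an order\<close>

lemma partial_order_subset:
  assumes "partial_order L" "S \<subseteq> carrier L"
  shows "partial_order (L\<lparr>carrier := S\<rparr>)"
proof -
  interpret partial_order L by fact
  interpret S: weak_partial_order "L\<lparr>carrier := S\<rparr>"
    by (rule weak_partial_order_subset[OF weak_partial_order_axioms assms(2)])
  show ?thesis by unfold_locales (simp add: eq_is_equal)
qed

text \<open>The upper bounds in the smaller carrier are the ambient ones that lie in
  \<open>S\<close>, so an ambient supremum lying in \<open>S\<close> is still least among them. A
  supremum formed only within \<open>S\<close> could be larger, hence the condition
  \<open>s \<in> S\<close>.\<close>

lemma is_lub_subset: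
  assumes "is_lub L s A" "A \<subseteq> S" "S \<subseteq> carrier L" "s \<in> S"
  shows "is_lub (L\<lparr>carrier := S\<rparr>) s A"
proof -
  have "Upper (L\<lparr>carrier := S\<rparr>) A = Upper L A \<inter> S"
    using assms(2,3) by (auto simp: Upper_def)
  with assms show ?thesis by (auto simp: least_def)
qed

lemma is_glb_subset:
  assumes "is_glb L s A" "A \<subseteq> S" "S \<subseteq> carrier L" "s \<in> S"
  shows "is_glb (L\<lparr>carrier := S\<rparr>) s A"
proof -
  have "Lower (L\<lparr>carrier := S\<rparr>) A = Lower L A \<inter> S"
    using assms(2,3) by (auto simp: Lower_def)
  with assms show ?thesis by (auto simp: greatest_def)
qed

lemma least_carrier_subset:
  assumes "least L b (carrier L)" "S \<subseteq> carrier L" "b \<in> S"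
  shows "least (L\<lparr>carrier := S\<rparr>) b S"
  using assms by (auto simp: least_def)

lemma greatest_carrier_subset:
  assumes "greatest L t (carrier L)" "S \<subseteq> carrier L" "t \<in> S"
  shows "greatest (L\<lparr>carrier := S\<rparr>) t S"
  using assms by (auto simp: greatest_def)

text \<open>Joins are chosen by \<open>SOME\<close>, so joins over two different carriers can be
  compared only through uniqueness of suprema, which is where antisymmetry enters. The next three
  lemmas serve the same purpose.\<close>

lemma (in partial_order) join_eqI: "is_lub L s {x, y} \<Longrightarrow> x \<squnion> y = s"
  unfolding join_def sup_def by (blast intro: some_equality least_unique)

lemma (in partial_order) meet_eqI: "is_glb L s {x, y} \<Longrightarrow> x \<sqinter> y = s"
  unfolding meet_def inf_def by (blast intro: some_equality greatest_unique)

lemma (in partial_order) bottom_eqI: "least L b (carrier L) \<Longrightarrow> \<bottom> = b"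
  unfolding bottom_def by (blast intro: some_equality least_unique)

lemma (in partial_order) top_eqI: "greatest L t (carrier L) \<Longrightarrow> \<top> = t"
  unfolding top_def by (blast intro: some_equality greatest_unique)

section \<open>Subsets closed under finite joins\<close>

context join_semilattice
begin

context
  fixes S
  assumes sub: "S \<subseteq> carrier M" and bot: "\<bottom> \<in> S"
    and join_in: "\<forall>x\<in>S. \<forall>y\<in>S. x \<squnion> y \<in> S"
begin

interpretation S: partial_order "M\<lparr>carrier := S\<rparr>"
  by (rule partial_order_subset[OF partial_order_axioms sub])

lemma subset_is_lub: "\<lbrakk>x \<in> S; y \<in> S\<rbrakk> \<Longrightarrow> is_lub (M\<lparr>carrier := S\<rparr>) (x \<squnion> y) {x, y}"
  using sub join_in by (intro is_lub_subset) (auto simp: join_def intro!: sup_of_two_least)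

lemma subset_bottom_least: "least (M\<lparr>carrier := S\<rparr>) \<bottom> S"
  by (rule least_carrier_subset[OF bottom_least sub bot])

lemma join_semilattice_subset: "join_semilattice (M\<lparr>carrier := S\<rparr>)"
  using subset_is_lub subset_bottom_least by unfold_locales auto

lemma subset_join: "\<lbrakk>x \<in> S; y \<in> S\<rbrakk> \<Longrightarrow> x \<squnion>\<^bsub>M\<lparr>carrier := S\<rparr>\<^esub> y = x \<squnion> y"
  by (rule S.join_eqI[OF subset_is_lub])

lemma subset_bottom: "\<bottom>\<^bsub>M\<lparr>carrier := S\<rparr>\<^esub> = \<bottom>"
  using subset_bottom_least by (intro S.bottom_eqI) simp

end

end

section \<open>Sublattices of distributive lattices\<close>

context distributive_lattice
begin

context
  fixes S
  assumes sublat: "sublattice S L"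
begin

lemma sublatticeD:
  "S \<subseteq> carrier L" "\<bottom> \<in> S" "\<top> \<in> S"
  "\<And>x y. \<lbrakk>x \<in> S; y \<in> S\<rbrakk> \<Longrightarrow> x \<sqinter> y \<in> S"
  "\<And>x y. \<lbrakk>x \<in> S; y \<in> S\<rbrakk> \<Longrightarrow> x \<squnion> y \<in> S"
  using sublat by (auto simp: sublattice_def)

interpretation J: join_semilattice L ..

lemma sublattice_join_closed: "\<forall>x\<in>S. \<forall>y\<in>S. x \<squnion> y \<in> S"
  using sublatticeD(5) by blast

interpretation S: partial_order "L\<lparr>carrier := S\<rparr>"
  by (rule partial_order_subset[OF partial_order_axioms sublatticeD(1)])

lemma sublattice_is_glb: "\<lbrakk>x \<in> S; y \<in> S\<rbrakk> \<Longrightarrow> is_glb (L\<lparr>carrier := S\<rparr>) (x \<sqinter> y) {x, y}"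
  using sublatticeD by (intro is_glb_subset) (auto simp: meet_def intro!: inf_of_two_greatest)

lemma sublattice_top_greatest: "greatest (L\<lparr>carrier := S\<rparr>) \<top> S"
  by (rule greatest_carrier_subset[OF top_greatest sublatticeD(1,3)])

text \<open>A lattice is in particular a join semilattice, so the facts on joins and the least
  element are inherited; only meets and the greatest element need a dual argument.\<close>

lemmas sublattice_join = J.subset_join[OF sublatticeD(1,2) sublattice_join_closed]
lemmas sublattice_bottom = J.subset_bottom[OF sublatticeD(1,2) sublattice_join_closed]

lemma sublattice_meet: "\<lbrakk>x \<in> S; y \<in> S\<rbrakk> \<Longrightarrow> x \<sqinter>\<^bsub>L\<lparr>carrier := S\<rparr>\<^esub> y = x \<sqinter> y"
  by (rule S.meet_eqI[OF sublattice_is_glb])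

lemma sublattice_top: "\<top>\<^bsub>L\<lparr>carrier := S\<rparr>\<^esub> = \<top>"
  using sublattice_top_greatest by (intro S.top_eqI) simp

lemma distributive_lattice_sublattice: "distributive_lattice (L\<lparr>carrier := S\<rparr>)"
proof -
  \<comment> \<open>This settles existence of joins and of a least element, leaving meets, the
    greatest element and distributivity. The last is an equation between operations that agree with
    the ambient ones.\<close>
  interpret SJ: join_semilattice "L\<lparr>carrier := S\<rparr>"
    by (rule J.join_semilattice_subset[OF sublatticeD(1,2) sublattice_join_closed])
  show ?thesis
  proof unfold_locales
    fix x y z
    assume "x \<in> carrier (L\<lparr>carrier := S\<rparr>)" "y \<in> carrier (L\<lparr>carrier := S\<rparr>)"
      "z \<in> carrier (L\<lparr>carrier := S\<rparr>)"
    then have S: "x \<in> S" "y \<in> S" "z \<in> S" by simp_all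
    then have "x \<sqinter> (y \<squnion> z) = (x \<sqinter> y) \<squnion> (x \<sqinter> z)"
      using sublatticeD(1) by (intro inf_sup_distrib) auto
    with S sublatticeD(4,5)
    show "x \<sqinter>\<^bsub>L\<lparr>carrier := S\<rparr>\<^esub> (y \<squnion>\<^bsub>L\<lparr>carrier := S\<rparr>\<^esub> z) =
        (x \<sqinter>\<^bsub>L\<lparr>carrier := S\<rparr>\<^esub> y) \<squnion>\<^bsub>L\<lparr>carrier := S\<rparr>\<^esub> (x \<sqinter>\<^bsub>L\<lparr>carrier := S\<rparr>\<^esub> z)"
      by (simp add: sublattice_meet sublattice_join)
  qed (use sublattice_is_glb sublattice_top_greatest in auto)
qed

end

end

section \<open>Negation in Heyting algebras and Heyting modules\<close>

context heyting_algebra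
begin

lemma heyting_imp:
  assumes "y \<in> carrier H" "z \<in> carrier H"
  shows "heyting_imp H y z \<in> carrier H \<and>
    (\<forall>x\<in>carrier H. x \<sqinter> y \<sqsubseteq> z \<longleftrightarrow> x \<sqsubseteq> heyting_imp H y z)"
  unfolding heyting_imp_def
proof (rule theI')
  show "\<exists>!w. w \<in> carrier H \<and> (\<forall>x\<in>carrier H. x \<sqinter> y \<sqsubseteq> z \<longleftrightarrow> x \<sqsubseteq> w)"
    \<comment> \<open>Uniqueness: a candidate satisfies its own equivalence at itself, hence lies
      below any other candidate; antisymmetry finishes.\<close>
    using imp_exists[OF assms] le_antisym le_refl by (metis (no_types, lifting))
qed

lemma neg_closed: "x \<in> carrier H \<Longrightarrow> heyting_neg H x \<in> carrier H"
  unfolding heyting_neg_def using heyting_imp by simp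

lemma le_neg_iff:
  "\<lbrakk>x \<in> carrier H; y \<in> carrier H\<rbrakk> \<Longrightarrow> x \<sqsubseteq> heyting_neg H y \<longleftrightarrow> x \<sqinter> y \<sqsubseteq> \<bottom>"
  unfolding heyting_neg_def using heyting_imp by simp

lemma le_bottom_iff: "x \<in> carrier H \<Longrightarrow> x \<sqsubseteq> \<bottom> \<longleftrightarrow> x = \<bottom>"
  by (auto intro: le_antisym)

lemma meet_neg: "x \<in> carrier H \<Longrightarrow> x \<sqinter> heyting_neg H x = \<bottom>"
  using le_neg_iff[of "heyting_neg H x" x] le_bottom_iff
  by (simp add: neg_closed meet_comm[of H x])

lemma neg_bottom: "heyting_neg H \<bottom> = \<top>"
  using le_neg_iff[of \<top> \<bottom>] by (auto intro!: le_antisym simp: neg_closed meet_right)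

lemma neg_regular: "x \<in> regular_elements H \<Longrightarrow> heyting_neg H x \<in> regular_elements H"
  by (auto simp: regular_elements_def neg_closed)

lemma regular_closed: "x \<in> regular_elements H \<Longrightarrow> x \<in> carrier H"
  by (simp add: regular_elements_def)

text \<open>By distributivity, \<open>?u\<close> is disjoint from both \<open>x\<close> and its
  negation. Disjointness from \<open>x\<close> puts \<open>?u\<close> below the negation of
  \<open>x\<close>, from which it is also disjoint, so \<open>?u\<close> is
  \<open>\<bottom>\<close>.\<close>

lemma neg_join_neg:
  assumes x: "x \<in> carrier H"
  shows "heyting_neg H (x \<squnion> heyting_neg H x) = \<bottom>"
proof -
  let ?w = "x \<squnion> heyting_neg H x" and ?u = "heyting_neg H (x \<squnion> heyting_neg H x)"
  have nx: "heyting_neg H x \<in> carrier H" using x by (rule neg_closed)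
  have w: "?w \<in> carrier H" using x nx by simp
  have u: "?u \<in> carrier H" using w by (rule neg_closed)
  have "(?u \<sqinter> x) \<squnion> (?u \<sqinter> heyting_neg H x) = \<bottom>"
    using meet_neg[OF w] by (simp add: inf_sup_distrib[OF u x nx, symmetric] meet_comm[of H ?w])
  then have *: "?u \<sqinter> x \<sqsubseteq> \<bottom>" "?u \<sqinter> heyting_neg H x \<sqsubseteq> \<bottom>"
    using join_left[of "?u \<sqinter> x" "?u \<sqinter> heyting_neg H x"]
      join_right[of "?u \<sqinter> x" "?u \<sqinter> heyting_neg H x"] u x nx by simp_all
  have "?u \<sqsubseteq> heyting_neg H x" using le_neg_iff[OF u x] * by simp
  \<comment> \<open>Despite its name, \<open>le_iff_join\<close> expresses the order through meets:
    \<open>x \<sqsubseteq> y\<close> iff \<open>x = x \<sqinter> y\<close>.\<close>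
  then have "?u = ?u \<sqinter> heyting_neg H x" using le_iff_join[OF u nx] by simp
  with *(2) show ?thesis using le_bottom_iff[OF u] by simp
qed

section \<open>Complements when the regular elements form a sublattice\<close>

context
  assumes sublat: "sublattice (regular_elements H) H"
begin

lemma join_neg_regular:
  assumes x: "x \<in> regular_elements H"
  shows "x \<squnion> heyting_neg H x = \<top>"
proof -
  have "x \<squnion> heyting_neg H x \<in> regular_elements H"
    by (rule sublatticeD(5)[OF sublat x neg_regular[OF x]])
  then have "x \<squnion> heyting_neg H x = heyting_neg H (heyting_neg H (x \<squnion> heyting_neg H x))"
    by (simp add: regular_elements_def)
  then show ?thesis using neg_join_neg[OF regular_closed[OF x]] neg_bottom by simp
qed

text \<open>A regular \<open>x\<close> is complemented in \<open>H\<close> itself, so the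
  implication from \<open>x\<close> to \<open>z\<close> takes its classical form even when
  \<open>z\<close> is not regular.\<close>

lemma meet_le_iff_le_join_neg:
  assumes x: "x \<in> regular_elements H" and y: "y \<in> carrier H" and z: "z \<in> carrier H"
  shows "y \<sqinter> x \<sqsubseteq> z \<longleftrightarrow> y \<sqsubseteq> heyting_neg H x \<squnion> z"
proof -
  have xc: "x \<in> carrier H" and nx: "heyting_neg H x \<in> carrier H"
    using x by (auto intro: regular_closed neg_closed)
  let ?r = "heyting_neg H x \<squnion> z"
  have r: "?r \<in> carrier H" using nx z by simp
  show ?thesis
  proof
    assume le: "y \<sqinter> x \<sqsubseteq> z"
    \<comment> \<open>Excluded middle for \<open>x\<close> splits \<open>y\<close> into a part below
      \<open>z\<close> and a part below the negation of \<open>x\<close>.\<close>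
    have "y = y \<sqinter> (x \<squnion> heyting_neg H x)"
      using le_iff_join[OF y top_closed] y by (simp add: join_neg_regular[OF x])
    also have "\<dots> = (y \<sqinter> x) \<squnion> (y \<sqinter> heyting_neg H x)" by (rule inf_sup_distrib[OF y xc nx])
    also have "\<dots> \<sqsubseteq> ?r"
    proof (rule join_le)
      show "y \<sqinter> x \<sqsubseteq> ?r" by (rule le_trans[OF le join_right]) (use y xc nx z in simp_all)
      show "y \<sqinter> heyting_neg H x \<sqsubseteq> ?r"
        by (rule le_trans[OF meet_right join_left]) (use y xc nx z in simp_all)
    qed (use y xc nx r in simp_all)
    finally show "y \<sqsubseteq> ?r" .
  next
    assume le: "y \<sqsubseteq> ?r"
    \<comment> \<open>Meeting \<open>?r\<close> with \<open>x\<close> removes the disjunct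
      \<open>heyting_neg H x\<close> and leaves only \<open>x \<sqinter> z\<close>.\<close>
    have "y \<sqinter> x \<sqsubseteq> x \<sqinter> ?r"
      by (intro meet_le meet_right le_trans[OF meet_left le]) (use y xc r in simp_all)
    also have "x \<sqinter> ?r = (x \<sqinter> heyting_neg H x) \<squnion> (x \<sqinter> z)" by (rule inf_sup_distrib[OF xc nx z])
    also have "\<dots> \<sqsubseteq> z"
      using xc z by (intro join_le) (auto simp: meet_neg meet_right)
    finally show "y \<sqinter> x \<sqsubseteq> z" using y xc nx z by simp
  qed
qed

lemma boolean_lattice_regular_part: "boolean_lattice (regular_part H) (heyting_neg H)"
proof -
  interpret R: distributive_lattice "H\<lparr>carrier := regular_elements H\<rparr>"
    by (rule distributive_lattice_sublattice[OF sublat])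
  show ?thesis unfolding regular_part_def
    by unfold_locales
      (simp_all add: neg_regular regular_closed sublattice_meet[OF sublat] meet_neg
        sublattice_join[OF sublat] join_neg_regular sublattice_bottom[OF sublat]
        sublattice_top[OF sublat])
qed

end

end

section \<open>Laws of the module negation\<close>

context heyting_module
begin

lemma module_imp:
  assumes "m \<in> carrier M" "n \<in> carrier M"
  shows "module_imp H M act m n \<in> carrier H \<and>
    (\<forall>x\<in>carrier H. act x m \<sqsubseteq>\<^bsub>M\<^esub> n \<longleftrightarrow> x \<sqsubseteq> module_imp H M act m n)"
  unfolding module_imp_def
proof (rule theI')
  show "\<exists>!w. w \<in> carrier H \<and> (\<forall>x\<in>carrier H. act x m \<sqsubseteq>\<^bsub>M\<^esub> n \<longleftrightarrow> x \<sqsubseteq> w)"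
    using module_imp_exists[OF assms] H.le_antisym H.le_refl by (metis (no_types, lifting))
qed

lemma module_neg_closed: "m \<in> carrier M \<Longrightarrow> module_neg H M act m \<in> carrier H"
  unfolding module_neg_def using module_imp by simp

lemma le_module_neg_iff:
  "\<lbrakk>x \<in> carrier H; m \<in> carrier M\<rbrakk>
    \<Longrightarrow> x \<sqsubseteq> module_neg H M act m \<longleftrightarrow> act x m \<sqsubseteq>\<^bsub>M\<^esub> \<bottom>\<^bsub>M\<^esub>"
  unfolding module_neg_def using module_imp by simp

text \<open>An element of \<open>H\<close> is determined by the elements below it, so a module
  negation can be computed by finding which scalars annihilate \<open>m\<close>.\<close>

lemma module_neg_eqI:
  assumes m: "m \<in> carrier M" and w: "w \<in> carrier H"
    and iff: "\<And>x. x \<in> carrier H \<Longrightarrow> act x m \<sqsubseteq>\<^bsub>M\<^esub> \<bottom>\<^bsub>M\<^esub> \<longleftrightarrow> x \<sqsubseteq> w"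
  shows "module_neg H M act m = w"
  using iff[OF w] iff[OF module_neg_closed[OF m]] le_module_neg_iff[OF _ m] w
    module_neg_closed[OF m] by (intro H.le_antisym) auto

lemma module_neg_bottom: "module_neg H M act \<bottom>\<^bsub>M\<^esub> = \<top>"
  \<comment> \<open>Every scalar annihilates \<open>\<bottom>\<close>: it lies below
    \<open>\<top>\<close>, which acts as the identity.\<close>
  using act_mono_left[of _ \<top> "\<bottom>\<^bsub>M\<^esub>"] by (intro module_neg_eqI) (simp_all add: act_top)

text \<open>A scalar annihilates a join exactly when it annihilates both joinands, that is, when it
  lies below both negations.\<close>

lemma module_neg_join:
  assumes m: "m \<in> carrier M" and n: "n \<in> carrier M"
  shows "module_neg H M act (m \<squnion>\<^bsub>M\<^esub> n) = module_neg H M act m \<sqinter> module_neg H M act n"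
proof (rule module_neg_eqI)
  fix x assume x: "x \<in> carrier H"
  have c: "act x m \<in> carrier M" "act x n \<in> carrier M" using x m n act_closed by auto
  have d: "module_neg H M act m \<in> carrier H" "module_neg H M act n \<in> carrier H"
    using m n by (auto intro: module_neg_closed)
  have "act x (m \<squnion>\<^bsub>M\<^esub> n) \<sqsubseteq>\<^bsub>M\<^esub> \<bottom>\<^bsub>M\<^esub> \<longleftrightarrow>
      act x m \<sqsubseteq>\<^bsub>M\<^esub> \<bottom>\<^bsub>M\<^esub> \<and> act x n \<sqsubseteq>\<^bsub>M\<^esub> \<bottom>\<^bsub>M\<^esub>"
    unfolding act_join_right[OF x m n] using c M.join_left[OF c] M.join_right[OF c]
    by (meson M.bottom_closed M.join_closed M.join_le M.le_trans)
  also have "\<dots> \<longleftrightarrow> x \<sqsubseteq> module_neg H M act m \<and> x \<sqsubseteq> module_neg H M act n"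
    using x m n by (simp add: le_module_neg_iff)
  also have "\<dots> \<longleftrightarrow> x \<sqsubseteq> module_neg H M act m \<sqinter> module_neg H M act n"
    using x d H.meet_left[OF d] H.meet_right[OF d]
    by (meson H.le_trans H.meet_closed H.meet_le)
  finally show "act x (m \<squnion>\<^bsub>M\<^esub> n) \<sqsubseteq>\<^bsub>M\<^esub> \<bottom>\<^bsub>M\<^esub> \<longleftrightarrow>
      x \<sqsubseteq> module_neg H M act m \<sqinter> module_neg H M act n" .
qed (use m n in \<open>simp_all add: module_neg_closed\<close>)

text \<open>\<open>y\<close> annihilates \<open>act x m\<close> iff \<open>y \<sqinter> x\<close>
  annihilates \<open>m\<close>, that is, lies below the negation of \<open>m\<close>; the complement
  of \<open>x\<close> then moves \<open>x\<close> to the other side.\<close>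

lemma module_neg_act:
  assumes sublat: "sublattice (regular_elements H) H"
    and x: "x \<in> regular_elements H" and m: "m \<in> carrier M"
  shows "module_neg H M act (act x m) = heyting_neg H x \<squnion> module_neg H M act m"
proof (rule module_neg_eqI)
  have xc: "x \<in> carrier H" using x by (rule H.regular_closed)
  show "act x m \<in> carrier M" using xc m by (rule act_closed)
  show "heyting_neg H x \<squnion> module_neg H M act m \<in> carrier H"
    using xc m by (simp add: H.neg_closed module_neg_closed)
  fix y assume y: "y \<in> carrier H"
  show "act y (act x m) \<sqsubseteq>\<^bsub>M\<^esub> \<bottom>\<^bsub>M\<^esub> \<longleftrightarrow>
      y \<sqsubseteq> heyting_neg H x \<squnion> module_neg H M act m"
    using H.meet_le_iff_le_join_neg[OF sublat x y module_neg_closed[OF m]]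
      le_module_neg_iff[of "y \<sqinter> x" m] act_meet[OF y xc m] y xc m by simp
qed

lemma regular_moduleD:
  assumes "m \<in> regular_module_elements H M act"
  shows "m \<in> carrier M" "module_neg H M act m \<in> regular_elements H"
  using assms by (auto simp: regular_module_elements_def)

context
  assumes sublat: "sublattice (regular_elements H) H"
begin

text \<open>Here and in the next two lemmas, a law of the module negation reduces closure of the
  regular part of \<open>M\<close> to closure of the regular elements of \<open>H\<close>: under
  \<open>\<top>\<close>, meets and joins respectively.\<close>

lemma regular_module_bottom: "\<bottom>\<^bsub>M\<^esub> \<in> regular_module_elements H M act"
  using H.sublatticeD(3)[OF sublat] by (simp add: regular_module_elements_def module_neg_bottom)

lemma regular_module_join:
  "\<forall>m\<in>regular_module_elements H M act. \<forall>n\<in>regular_module_elements H M act.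
    m \<squnion>\<^bsub>M\<^esub> n \<in> regular_module_elements H M act"
  using H.sublatticeD(4)[OF sublat] by (simp add: regular_module_elements_def module_neg_join)

lemma regular_module_act:
  "\<lbrakk>x \<in> regular_elements H; m \<in> regular_module_elements H M act\<rbrakk>
    \<Longrightarrow> act x m \<in> regular_module_elements H M act"
  using H.sublatticeD(5)[OF sublat] H.neg_regular H.regular_closed act_closed
  by (simp add: regular_module_elements_def module_neg_act[OF sublat])

lemma regular_module_subset: "regular_module_elements H M act \<subseteq> carrier M"
  using regular_moduleD(1) by blast

lemmas regular_part_join =
  M.subset_join[OF regular_module_subset regular_module_bottom regular_module_join]
lemmas regular_part_bottom =
  M.subset_bottom[OF regular_module_subset regular_module_bottom regular_module_join]

lemma boolean_module_regular_part:
  "boolean_module (regular_part H) (heyting_neg H)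
    (regular_module_part H M act) act (module_neg H M act)"
proof -
  interpret B: boolean_lattice "H\<lparr>carrier := regular_elements H\<rparr>" "heyting_neg H"
    by (rule H.boolean_lattice_regular_part[OF sublat, unfolded regular_part_def])
  interpret N: join_semilattice "M\<lparr>carrier := regular_module_elements H M act\<rparr>"
    by (rule M.join_semilattice_subset
        [OF regular_module_subset regular_module_bottom regular_module_join])
  \<comment> \<open>The module axioms mention operations computed in the shrunken carriers; these
    equations turn them into the ambient ones, after which the axioms of \<open>M\<close>
    apply.\<close>
  note restr = H.sublattice_meet[OF sublat] H.sublattice_join[OF sublat]
    H.sublattice_bottom[OF sublat] H.sublattice_top[OF sublat]
    regular_part_join regular_part_bottom
  note closed = regular_module_act regular_moduleD H.regular_closed H.neg_regular
  show ?thesis unfolding regular_part_def regular_module_part_def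
  proof (intro boolean_module.intro distributive_module.intro distributive_module_axioms.intro
      boolean_module_axioms.intro B.boolean_lattice_axioms B.distributive_lattice_axioms
      N.join_semilattice_axioms)
  qed (simp_all add: closed restr act_mono_left act_mono_right act_top act_bottom act_meet
      act_join_left act_join_right module_neg_bottom module_neg_act[OF sublat] module_neg_join)
qed

end

end

text \<open>Action and negation are literally the ambient functions, whereas joins are recomputed
  from the order on the shrunken carrier. The last two conjuncts therefore record that they too are
  restricted from \<open>M\<close>.\<close>

theorem proposition3p13:
  fixes H :: "('a, 'c) gorder_scheme"
    and M :: "('b, 'd) gorder_scheme"
    and act :: "'a \<Rightarrow> 'b \<Rightarrow> 'b"
  assumes "heyting_algebra H"
    and "sublattice (regular_elements H) H"
    and "heyting_module H M act"
  shows "boolean_module (regular_part H) (heyting_neg H)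
      (regular_module_part H M act) act (module_neg H M act)
    \<and> \<bottom>\<^bsub>regular_module_part H M act\<^esub> = \<bottom>\<^bsub>M\<^esub>
    \<and> (\<forall>m\<in>regular_module_elements H M act. \<forall>n\<in>regular_module_elements H M act.
        m \<squnion>\<^bsub>regular_module_part H M act\<^esub> n = m \<squnion>\<^bsub>M\<^esub> n)"
proof -
  interpret heyting_module H M act by fact
  show ?thesis
    using boolean_module_regular_part[OF assms(2)] regular_part_bottom[OF assms(2)]
      regular_part_join[OF assms(2)]
    by (simp add: regular_module_part_def)
qed

end
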